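(* Let $p\ge3$ be an integer and let $A$ be a fixed zero-diagonal representative of an $\mathrm{SBIBD}(v,k,\lambda)$. If $A$ contains a pairwise separated set $F$ of size $p$ and $k\ge\lambda(p-1)+2$, then the replica count $q=\lambda(p-1)$ does not guarantee recovery, i.e. there are a finite object collection, a legal placement of it using exactly $\lambda(p-1)$ target nodes per object, and a set of at most $p$ failed nodes from which the placement does not permit recovery. Consequently, $$\lambda(p-1)+1\le q^*(A,p)\le\lambda(p-1)+2.$$
   Context: Symmetric design. For integers $1\le\lambda<k<v$, an $\mathrm{SBIBD}(v,k,\lambda)$ consists of $v$ points and $v$ blocks such that every block contains $k$ points, every point lies in $k$ blocks, and every two distinct points lie together in exactly $\lambda$ blocks. After independently labeling points and blocks by $0,1,\dots,v-1$, the incidence matrix $A=(A_{ij})\in\{0,1\}^{v\times v}$, with $A_{ij}=1$ iff point $i$ lies in block $j$, is called a representative of the SBIBD. It is zero-diagonal if $A_{ii}=0$ for all $i$. Coding model. There are $v$ nodes $0,\dots,v-1$. For a node $i$ let $\mathcal S_{\mathrm{tgt}}(i)=\{j:A_{ij}=1\}$ (admissible targets) and $\mathcal S_{\mathrm{src}}(i)=\{h:A_{hi}=1\}$ (sources); both have size $k$. There is a finite collection of data objects, each a binary word of one common positive length; $\oplus$ is componentwise addition over $\mathbb F_2$. Each object $x$ has exactly one primary copy, stored at its primary node $i$, and for the replica count $q\in\{0,\dots,k\}$ it selects a set $T_x\subseteq\mathcal S_{\mathrm{tgt}}(i)$ of exactly $q$ distinct target nodes (chosen separately for each object) and sends one replica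 to each node in $T_x$. A placement is legal if at each node $j$ the replicas received at $j$ are partitioned into $k$-tuples, each containing exactly one replica from every primary node in $\mathcal S_{\mathrm{src}}(j)$ (the partition is part of the placement). For each such tuple, consisting of objects $x_1,\dots,x_k$, node $j$ stores one parity $x_1\oplus\cdots\oplus x_k$; the replicas are then discarded. Failures and recovery. Given a set $F$ of failed nodes, all primary copies and parities stored at nodes of $F$ are lost, and those stored at other nodes are alive. A placement permits recovery from $F$ if the values of all objects whose primary node is in $F$ are uniquely determined by the alive primary copies and the alive parities (the placement being known). Universal replica threshold. For an integer $p\ge1$, $q^*(A,p)$ is the smallest integer $q\in\{0,1,\dots,k\}$ such that every legal placement of any finite object collection using exactly $q$ target nodes per object permits recovery from every set of at most $p$ failed nodes. Pairwise separated set. For $F\subseteq\{0,\dots,v-1\}$ and $t\in\{0,\dots,v-1\}$ let $d_F(t)=\sum_{i\in F}A_{it}$. The set $F$ is pairwise separated if $d_F(t)\le2$ for every $t\in\{0,\dots,v-1\}$. *)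

theory Defs
  imports Main "HOL-Library.FuncSet" "HOL-Library.Disjoint_Sets" "HOL-Library.Z2"
begin

(* Blocks are abstract objects related to points by inc, so that repeated blocks are not
   excluded by fiat. *)
definition sbibd ::
  "nat \<Rightarrow> nat \<Rightarrow> nat \<Rightarrow> 'p set \<Rightarrow> 'b set \<Rightarrow> ('p \<Rightarrow> 'b \<Rightarrow> bool) \<Rightarrow> bool" where
  "sbibd v k lam P B inc \<longleftrightarrow>
     1 \<le> lam \<and> lam < k \<and> k < v \<and>
     finite P \<and> card P = v \<and> finite B \<and> card B = v \<and>
     (\<forall>b\<in>B. card {x \<in> P. inc x b} = k) \<and>
     (\<forall>x\<in>P. card {b \<in> B. inc x b} = k) \<and>
     (\<forall>x\<in>P. \<forall>y\<in>P. x \<noteq> y \<longrightarrow> card {b \<in> B. inc x b \<and> inc y b} = lam)"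

(* A v x v matrix is a function of two indices, of which only the values at indices below v
   are relevant. *)
definition representative ::
  "nat \<Rightarrow> 'p set \<Rightarrow> 'b set \<Rightarrow> ('p \<Rightarrow> 'b \<Rightarrow> bool) \<Rightarrow> (nat \<Rightarrow> nat \<Rightarrow> nat) \<Rightarrow> bool" where
  "representative v P B inc A \<longleftrightarrow>
     (\<exists>pt bl. bij_betw pt {..<v} P \<and> bij_betw bl {..<v} B \<and>
        (\<forall>i<v. \<forall>j<v. A i j = (if inc (pt i) (bl j) then 1 else 0)))"

definition zero_diagonal :: "nat \<Rightarrow> (nat \<Rightarrow> nat \<Rightarrow> nat) \<Rightarrow> bool" where
  "zero_diagonal v A \<longleftrightarrow> (\<forall>i<v. A i i = 0)"

definition tgt :: "nat \<Rightarrow> (nat \<Rightarrow> nat \<Rightarrow> nat) \<Rightarrow> nat \<Rightarrow> nat set" where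
  "tgt v A i = {j. j < v \<and> A i j = 1}"

definition src :: "nat \<Rightarrow> (nat \<Rightarrow> nat \<Rightarrow> nat) \<Rightarrow> nat \<Rightarrow> nat set" where
  "src v A i = {h. h < v \<and> A h i = 1}"

(* Objects are named by natural numbers; distinct objects may carry equal words.  The k-tuples
   at a node are represented by the sets of their member objects: an object sends at most one
   replica to any given node, so the replicas at a node are in bijection with the objects
   targeting it. *)
record placement =
  objects :: "nat set"
  word_length :: nat
  primary :: "nat \<Rightarrow> nat"
  targets :: "nat \<Rightarrow> nat set"
  tuples :: "nat \<Rightarrow> nat set set"

definition received :: "placement \<Rightarrow> nat \<Rightarrow> nat set" where
  "received pl j = {x \<in> objects pl. j \<in> targets pl x}"

definition legal_placement ::
  "nat \<Rightarrow> nat \<Rightarrow> (nat \<Rightarrow> nat \<Rightarrow> nat) \<Rightarrow> nat \<Rightarrow> placement \<Rightarrow> bool" where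
  "legal_placement v k A q pl \<longleftrightarrow>
     finite (objects pl) \<and> 0 < word_length pl \<and>
     (\<forall>x\<in>objects pl. primary pl x < v \<and>
        targets pl x \<subseteq> tgt v A (primary pl x) \<and> card (targets pl x) = q) \<and>
     (\<forall>j<v. partition_on (received pl j) (tuples pl j) \<and>
        (\<forall>t\<in>tuples pl j. card t = k \<and> (\<forall>h\<in>src v A j. \<exists>!x. x \<in> t \<and> primary pl x = h)))"

definition words :: "nat \<Rightarrow> (nat \<Rightarrow> bit) set" where
  "words L = {..<L} \<rightarrow>\<^sub>E UNIV"

definition parity_word :: "nat \<Rightarrow> (nat \<Rightarrow> nat \<Rightarrow> bit) \<Rightarrow> nat set \<Rightarrow> nat \<Rightarrow> bit" where
  "parity_word L val t = (\<lambda>l\<in>{..<L}. \<Sum>x\<in>t. val x l)"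

definition permits_recovery :: "nat \<Rightarrow> placement \<Rightarrow> nat set \<Rightarrow> bool" where
  "permits_recovery v pl F \<longleftrightarrow>
     (\<forall>val \<in> objects pl \<rightarrow> words (word_length pl).
      \<forall>val' \<in> objects pl \<rightarrow> words (word_length pl).
        (\<forall>x\<in>objects pl. primary pl x \<notin> F \<longrightarrow> val x = val' x) \<and>
        (\<forall>j<v. j \<notin> F \<longrightarrow> (\<forall>t\<in>tuples pl j.
           parity_word (word_length pl) val t = parity_word (word_length pl) val' t))
        \<longrightarrow> (\<forall>x\<in>objects pl. primary pl x \<in> F \<longrightarrow> val x = val' x))"

definition guarantees_recovery ::
  "nat \<Rightarrow> nat \<Rightarrow> (nat \<Rightarrow> nat \<Rightarrow> nat) \<Rightarrow> nat \<Rightarrow> nat \<Rightarrow> bool" where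
  "guarantees_recovery v k A p q \<longleftrightarrow>
     (\<forall>pl. legal_placement v k A q pl \<longrightarrow>
        (\<forall>F. F \<subseteq> {..<v} \<and> card F \<le> p \<longrightarrow> permits_recovery v pl F))"

(* LEAST is unspecified if no q \<le> k guarantees recovery, so claims about this value should
   come with the existence of such a q. *)
definition universal_threshold ::
  "nat \<Rightarrow> nat \<Rightarrow> (nat \<Rightarrow> nat \<Rightarrow> nat) \<Rightarrow> nat \<Rightarrow> nat" where
  "universal_threshold v k A p = (LEAST q. q \<le> k \<and> guarantees_recovery v k A p q)"

definition pairwise_separated :: "nat \<Rightarrow> (nat \<Rightarrow> nat \<Rightarrow> nat) \<Rightarrow> nat set \<Rightarrow> bool" where
  "pairwise_separated v A F \<longleftrightarrow> F \<subseteq> {..<v} \<and> (\<forall>t<v. (\<Sum>i\<in>F. A i t) \<le> 2)"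

end

theory Submission
  imports Defs "HOL-Library.Nat_Bijection"
begin

text \<open>
  The difference of two object assignments that agree on everything alive has a support \<open>S\<close> of
  objects with failed primaries, and every alive parity tuple that meets \<open>S\<close> meets it at least
  twice, hence in objects of two distinct primaries.

  Upper bound: let \<open>I\<close> be the set of primaries of \<open>S\<close> and \<open>s = |I|\<close>. A target of an object of \<open>S\<close>
  with primary \<open>i\<close> either has another source in \<open>I\<close>, which happens for at most \<open>\<lambda>(s - 1)\<close> targets,
  or is a failed node whose only source in \<open>I\<close> is \<open>i\<close>. The latter nodes are disjoint for distinct
  \<open>i\<close>, so summing over \<open>I\<close> gives \<open>s q \<le> s \<lambda> (s - 1) + p\<close>, which fails for \<open>q = \<lambda>(p - 1) + 2\<close>.

  Lower bound, for every \<open>q \<le> \<lambda>(p - 1)\<close>: take one object for each pair of a node \<open>i\<close> and a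
  \<open>q\<close>-subset of its admissible targets. By symmetry every node receives equally many replicas from
  each of its sources. For \<open>i\<close> in the pairwise separated set \<open>F\<close>, exactly \<open>\<lambda>(p - 1)\<close> admissible
  targets have precisely one further source in \<open>F\<close>; the objects of \<open>i\<close> with all targets among
  these form \<open>S\<close>. A node receiving objects of \<open>S\<close> receives equally many of them from exactly two
  sources, so they can be paired up inside its tuples.
\<close>

section \<open>Counting and enumerating finite sets\<close>

text \<open>The subsets avoiding \<open>j\<close> are subtracted from all \<open>q\<close>-subsets.
  Unlike \<open>(card X - 1) choose (q - 1)\<close>, this form stays correct for
  \<open>q = 0\<close>.\<close>

lemma card_subsets_containing:
  assumes "finite X" "j \<in> X"
  shows "card {T. T \<subseteq> X \<and> card T = q \<and> j \<in> T} = (card X choose q) - ((card X - 1) choose q)"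
proof -
  have eq: "{T. T \<subseteq> X \<and> card T = q \<and> j \<in> T} =
      {T. T \<subseteq> X \<and> card T = q} - {T. T \<subseteq> X - {j} \<and> card T = q}"
    by auto
  have fin: "finite {T. T \<subseteq> X - {j} \<and> card T = q}"
    using assms(1) by simp
  show ?thesis
    unfolding eq
    by (subst card_Diff_subset[OF fin]) (use assms in \<open>auto simp: n_subsets\<close>)
qed

text \<open>Listing \<open>S\<close> first lets the objects of \<open>S\<close> coming from
  different sources be aligned at equal indices.\<close>

lemma bij_betw_initial_segment:
  fixes R S :: "'a set"
  assumes "finite R" "S \<subseteq> R"
  obtains f where "bij_betw f {..<card R} R" "\<And>m. m < card R \<Longrightarrow> f m \<in> S \<longleftrightarrow> m < card S"
proof -
  have finS: "finite S" and finD: "finite (R - S)"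
    using assms finite_subset by auto
  obtain g where g: "bij_betw g {..<card S} S"
    using ex_bij_betw_nat_finite[OF finS] by (auto simp: atLeast0LessThan)
  have le: "card S \<le> card R" and cD: "card (R - S) = card {card S..<card R}"
    using assms finS by (auto simp: card_mono card_Diff_subset)
  obtain h where h: "bij_betw h {card S..<card R} (R - S)"
    using finite_same_card_bij[OF _ finD] cD by (metis finite_atLeastLessThan)
  define f where "f = (\<lambda>m. if m \<in> {..<card S} then g m else h m)"
  have 1: "bij_betw f ({..<card S} \<union> {card S..<card R}) (S \<union> (R - S))"
    unfolding f_def by (rule bij_betw_disjoint_Un[OF g h]) auto
  have "{..<card S} \<union> {card S..<card R} = {..<card R}" "S \<union> (R - S) = R"
    using le assms(2) by auto
  with 1 have "bij_betw f {..<card R} R"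
    by simp
  moreover have "f m \<in> S \<longleftrightarrow> m < card S" if "m < card R" for m
  proof (cases "m < card S")
    case True
    then show ?thesis using bij_betwE[OF g] by (auto simp: f_def)
  next
    case False
    then show ?thesis using bij_betwE[OF h] that by (auto simp: f_def)
  qed
  ultimately show ?thesis using that by blast
qed

section \<open>Symmetric designs as matrices\<close>

locale symmetric_design =
  fixes v k lam :: nat and A :: "nat \<Rightarrow> nat \<Rightarrow> nat"
  assumes entries: "\<lbrakk>i < v; j < v\<rbrakk> \<Longrightarrow> A i j = 0 \<or> A i j = 1"
    and card_tgt: "i < v \<Longrightarrow> card (tgt v A i) = k"
    and card_src: "j < v \<Longrightarrow> card (src v A j) = k"
    and card_common: "\<lbrakk>i < v; h < v; i \<noteq> h\<rbrakk> \<Longrightarrow> card (tgt v A i \<inter> tgt v A h) = lam"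
    and lam_pos: "0 < lam"
    and k_pos: "0 < k"
begin

abbreviation "Tgt \<equiv> tgt v A"
abbreviation "Src \<equiv> src v A"

lemma finite_Tgt [simp]: "finite (Tgt i)" and finite_Src [simp]: "finite (Src j)"
  by (simp_all add: tgt_def src_def)

lemma Tgt_less: "j \<in> Tgt i \<Longrightarrow> j < v" and Src_less: "h \<in> Src j \<Longrightarrow> h < v"
  by (simp_all add: tgt_def src_def)

lemma mem_Src_iff: "\<lbrakk>h < v; j < v\<rbrakk> \<Longrightarrow> h \<in> Src j \<longleftrightarrow> j \<in> Tgt h"
  by (simp add: tgt_def src_def)

lemma sum_entries_eq_card:
  assumes "I \<subseteq> {..<v}" "t < v"
  shows "(\<Sum>i\<in>I. A i t) = card (Src t \<inter> I)"
proof -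
  have "finite I" using assms(1) finite_subset by blast
  have "(\<Sum>i\<in>I. A i t) = (\<Sum>i\<in>I. if i \<in> Src t then 1 else 0)"
    using entries assms by (intro sum.cong) (fastforce simp: src_def)+
  also have "\<dots> = card (Src t \<inter> I)"
    using \<open>finite I\<close> by (simp add: sum.If_cases Int_commute)
  finally show ?thesis .
qed

text \<open>Double counting of pairs of a target \<open>t\<close> of \<open>i\<close> and a source
  \<open>h\<close> of \<open>t\<close> in \<open>J\<close>: each \<open>h\<close> contributes the
  \<open>lam\<close> common targets of \<open>i\<close> and \<open>h\<close>.\<close>

lemma sum_other_sources:
  assumes "i < v" "J \<subseteq> {..<v}" "i \<notin> J"
  shows "(\<Sum>t\<in>Tgt i. card (Src t \<inter> J)) = lam * card J"
proof -
  have fin: "finite J" using assms(2) finite_subset by blast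
  have "(\<Sum>t\<in>Tgt i. card (Src t \<inter> J)) = (\<Sum>t\<in>Tgt i. \<Sum>h\<in>J. if h \<in> Src t then 1 else 0)"
    using fin by (simp add: sum.If_cases Int_commute)
  also have "\<dots> = (\<Sum>h\<in>J. \<Sum>t\<in>Tgt i. if h \<in> Src t then 1 else 0)"
    by (rule sum.swap)
  also have "\<dots> = (\<Sum>h\<in>J. card (Tgt i \<inter> Tgt h))"
  proof (rule sum.cong)
    fix h assume "h \<in> J"
    then have "Tgt i \<inter> {t. h \<in> Src t} = Tgt i \<inter> Tgt h"
      using assms(2) Tgt_less mem_Src_iff by blast
    then show "(\<Sum>t\<in>Tgt i. if h \<in> Src t then 1 else 0) = card (Tgt i \<inter> Tgt h)"
      by (simp add: sum.If_cases)
  qed simp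
  also have "\<dots> = (\<Sum>h\<in>J. lam)"
    using assms by (intro sum.cong) (auto intro!: card_common)
  finally show ?thesis by simp
qed

section \<open>Upper bound: targets of undetermined objects\<close>

lemma replicas_le_failed:
  assumes legal: "legal_placement v k A q pl"
    and F: "F \<subseteq> {..<v}"
    and not_rec: "\<not> permits_recovery v pl F"
  obtains s where "1 \<le> s" "s \<le> card F" "s * q \<le> s * (lam * (s - 1)) + card F"
proof -
  have finF: "finite F" using F finite_subset by blast
  let ?L = "word_length pl"
  obtain val val' x0 where val: "val \<in> objects pl \<rightarrow> words ?L" and val': "val' \<in> objects pl \<rightarrow> words ?L"
    and alive: "\<And>x. x \<in> objects pl \<Longrightarrow> primary pl x \<notin> F \<Longrightarrow> val x = val' x"
    and par: "\<And>j t. \<lbrakk>j < v; j \<notin> F; t \<in> tuples pl j\<rbrakk> \<Longrightarrow> parity_word ?L val t = parity_word ?L val' t"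
    and x0: "x0 \<in> objects pl" "val x0 \<noteq> val' x0"
    using not_rec unfolding permits_recovery_def by blast
  \<comment> \<open>Fixing one coordinate reduces words to bits. Words are extensional, so two
    different ones differ below the word length.\<close>
  obtain l where l: "l < ?L" "val x0 l \<noteq> val' x0 l"
  proof -
    have "val x0 \<in> {..<?L} \<rightarrow>\<^sub>E UNIV" "val' x0 \<in> {..<?L} \<rightarrow>\<^sub>E UNIV"
      using val val' x0(1) by (auto simp: words_def)
    then show ?thesis
      using PiE_ext[of "val x0" "{..<?L}" "\<lambda>_. UNIV" "val' x0"] x0(2) that by auto
  qed
  define S where "S = {x \<in> objects pl. val x l \<noteq> val' x l}"
  define I where "I = primary pl ` S"
  have I_F: "I \<subseteq> F" unfolding I_def S_def using alive by fastforce
  have I_v: "I \<subseteq> {..<v}" and finI: "finite I"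
    using I_F F finF finite_subset by auto
  define U where "U i = {t \<in> F. Src t \<inter> I = {i}}" for i
  have bound: "q \<le> lam * (card I - 1) + card (U i)" if "i \<in> I" for i
  proof -
    obtain x where x: "x \<in> S" "primary pl x = i"
      using \<open>i \<in> I\<close> by (auto simp: I_def)
    have xo: "x \<in> objects pl" and xl: "val x l \<noteq> val' x l" using x by (auto simp: S_def)
    have iv: "i < v" and tg: "targets pl x \<subseteq> Tgt i" and ct: "card (targets pl x) = q"
      using legal xo x(2) by (auto simp: legal_placement_def)
    have fint: "finite (targets pl x)" using finite_subset[OF tg] by simp
    define J where "J = I - {i}"
    \<comment> \<open>If \<open>i\<close> were the only source of \<open>j\<close> in
      \<open>I\<close>, then \<open>x\<close> would be the only member of its tuple with differing
      values, since a tuple holds one object per source. Cancelling the other members from the equal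
      parities would make \<open>x\<close> agree at \<open>l\<close>.\<close>
    have other: "Src j \<inter> J \<noteq> {}" if j: "j \<in> targets pl x" "j \<notin> F" for j
    proof (rule ccontr)
      assume none: "\<not> Src j \<inter> J \<noteq> {}"
      have jv: "j < v" using j tg Tgt_less by blast
      have pt: "partition_on (received pl j) (tuples pl j)"
        and tup: "\<And>t. t \<in> tuples pl j \<Longrightarrow> card t = k \<and> (\<forall>h\<in>Src j. \<exists>!x. x \<in> t \<and> primary pl x = h)"
        using legal jv by (auto simp: legal_placement_def)
      have "x \<in> received pl j" using xo j by (simp add: received_def)
      then obtain t where t: "t \<in> tuples pl j" "x \<in> t"
        using pt by (auto simp: partition_on_def)
      have t_sub: "t \<subseteq> received pl j"
        using pt t(1) by (auto simp: partition_on_def)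
      have fint: "finite t" using tup[OF t(1)] k_pos card_ge_0_finite by auto
      have eq: "val y l = val' y l" if "y \<in> t - {x}" for y
      proof (rule ccontr)
        assume ne: "val y l \<noteq> val' y l"
        have yo: "y \<in> objects pl" "j \<in> targets pl y"
          using that t_sub by (auto simp: received_def)
        have yv: "primary pl y < v" "j \<in> Tgt (primary pl y)"
          using legal yo by (auto simp: legal_placement_def)
        have "primary pl y \<in> I" using yo ne by (auto simp: I_def S_def)
        moreover have "primary pl y \<in> Src j" using yv jv mem_Src_iff by simp
        ultimately have "primary pl y = i" using none by (auto simp: J_def)
        moreover have "i \<in> Src j" using iv jv j tg mem_Src_iff by auto
        ultimately show False
          using tup[OF t(1)] t(2) x(2) that by blast
      qed
      have "(\<Sum>y\<in>t. val y l) = (\<Sum>y\<in>t. val' y l)"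
        using fun_cong[OF par[OF jv j(2) t(1)], of l] l(1) by (simp add: parity_word_def)
      moreover have "(\<Sum>y\<in>t - {x}. val y l) = (\<Sum>y\<in>t - {x}. val' y l)"
        by (rule sum.cong) (simp_all add: eq)
      ultimately show False
        using xl sum.remove[OF fint t(2), of "\<lambda>y. val y l"] sum.remove[OF fint t(2), of "\<lambda>y. val' y l"]
        by (metis add_right_cancel)
    qed
    let ?M = "{t \<in> targets pl x. Src t \<inter> J \<noteq> {}}"
    have "targets pl x \<subseteq> ?M \<union> U i"
    proof
      fix t assume t: "t \<in> targets pl x"
      then have "i \<in> Src t" using tg iv Tgt_less mem_Src_iff by blast
      then show "t \<in> ?M \<union> U i"
        using t other[OF t] \<open>i \<in> I\<close> by (auto simp: U_def J_def)
    qed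
    then have "q \<le> card (?M \<union> U i)"
      unfolding ct[symmetric] by (rule card_mono[rotated]) (use fint finF in \<open>auto simp: U_def\<close>)
    also have "\<dots> \<le> card ?M + card (U i)" by (rule card_Un_le)
    also have "card ?M \<le> (\<Sum>t\<in>?M. card (Src t \<inter> J))"
    proof -
      have "(\<Sum>t\<in>?M. 1) \<le> (\<Sum>t\<in>?M. card (Src t \<inter> J))"
        by (rule sum_mono) (auto simp: Suc_le_eq card_gt_0_iff)
      then show ?thesis by simp
    qed
    also have "\<dots> \<le> (\<Sum>t\<in>Tgt i. card (Src t \<inter> J))"
      by (rule sum_mono2) (use tg in auto)
    also have "\<dots> = lam * card J"
      by (rule sum_other_sources[OF iv]) (use I_v in \<open>auto simp: J_def\<close>)
    also have "card J = card I - 1"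
      using finI \<open>i \<in> I\<close> by (simp add: J_def)
    finally show ?thesis by simp
  qed
  have "card I * q = (\<Sum>i\<in>I. q)" by simp
  also have "\<dots> \<le> (\<Sum>i\<in>I. lam * (card I - 1) + card (U i))"
    by (rule sum_mono) (rule bound)
  also have "\<dots> = card I * (lam * (card I - 1)) + (\<Sum>i\<in>I. card (U i))"
    by (simp add: sum.distrib)
  also have "(\<Sum>i\<in>I. card (U i)) = card (\<Union>i\<in>I. U i)"
    by (rule card_UN_disjoint[symmetric]) (use finI finF in \<open>auto simp: U_def\<close>)
  also have "\<dots> \<le> card F"
    by (rule card_mono[OF finF]) (auto simp: U_def)
  finally have "card I * q \<le> card I * (lam * (card I - 1)) + card F" by simp
  moreover have "x0 \<in> S" using x0 l by (simp add: S_def)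
  then have "1 \<le> card I" using finI by (auto simp: Suc_le_eq card_gt_0_iff I_def)
  moreover have "card I \<le> card F" using I_F finF card_mono by blast
  ultimately show ?thesis using that by blast
qed

lemma guarantees_recovery_upper:
  assumes "1 \<le> p"
  shows "guarantees_recovery v k A p (lam * (p - 1) + 2)"
  unfolding guarantees_recovery_def
proof (intro allI impI, rule ccontr)
  fix pl G
  assume "legal_placement v k A (lam * (p - 1) + 2) pl" and G: "G \<subseteq> {..<v} \<and> card G \<le> p"
    and "\<not> permits_recovery v pl G"
  then obtain s where s: "1 \<le> s" "s \<le> card G"
    "s * (lam * (p - 1) + 2) \<le> s * (lam * (s - 1)) + card G"
    using replicas_le_failed by metis
  \<comment> \<open>With \<open>p = s + r\<close> the inequality shrinks to
    \<open>s * (lam * r) + s \<le> r\<close>, impossible for positive \<open>s\<close> and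
    \<open>lam\<close>.\<close>
  obtain r where r: "p = s + r" using s(2) G le_trans le_Suc_ex by metis
  have "lam * (p - 1) = lam * (s - 1) + lam * r"
    using r s(1) by (simp flip: add_mult_distrib2)
  then have "s * (lam * (p - 1) + 2) = s * (lam * (s - 1)) + s * (lam * r) + 2 * s"
    by (simp only: add_mult_distrib2 mult.commute)
  then have "s * (lam * r) + s \<le> r"
    using s(3) G r by linarith
  moreover have "1 * r \<le> s * lam * r"
    using s(1) lam_pos by (intro mult_right_mono) simp_all
  ultimately show False using s(1) by (simp add: mult.assoc)
qed

section \<open>Lower bound: a placement without recovery\<close>

text \<open>The construction covers all \<open>q \<le> lam * (p - 1)\<close>, because bounding a
  least value from below means excluding every smaller candidate.\<close>

lemma no_guarantee_below:
  assumes sep: "pairwise_separated v A F"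
    and cF: "card F = p" "1 \<le> p"
    and q: "q \<le> lam * (p - 1)"
  obtains pl where "legal_placement v k A q pl" "\<not> permits_recovery v pl F"
proof -
  have F: "F \<subseteq> {..<v}" and sep2: "\<And>t. t < v \<Longrightarrow> card (Src t \<inter> F) \<le> 2"
    using sep sum_entries_eq_card by (auto simp: pairwise_separated_def)
  have finF: "finite F" using F finite_subset by blast
  define N where "N i = {t \<in> Tgt i. card (Src t \<inter> F) = 2}" for i
  have cN: "card (N i) = lam * (p - 1)" if i: "i \<in> F" for i
  proof -
    have iv: "i < v" using F i by auto
    \<comment> \<open>A target of \<open>i\<close> has one or two sources in \<open>F\<close>, one
      of them \<open>i\<close>. So the number of other sources is the indicator of
      \<open>N i\<close>, and the double count evaluates \<open>card (N i)\<close>.\<close>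
    have one: "card (Src t \<inter> (F - {i})) = (if t \<in> N i then 1 else 0)" if t: "t \<in> Tgt i" for t
    proof -
      have tv: "t < v" using t Tgt_less by simp
      have "Src t \<inter> (F - {i}) = Src t \<inter> F - {i}" "i \<in> Src t \<inter> F"
        using i t tv iv mem_Src_iff by auto
      then have "card (Src t \<inter> (F - {i})) = card (Src t \<inter> F) - 1" "card (Src t \<inter> F) \<noteq> 0"
        by (auto simp: card_gt_0_iff)
      then show ?thesis using sep2[OF tv] t by (auto simp: N_def)
    qed
    have "lam * card (F - {i}) = (\<Sum>t\<in>Tgt i. card (Src t \<inter> (F - {i})))"
      by (rule sum_other_sources[symmetric]) (use iv F in auto)
    also have "\<dots> = (\<Sum>t\<in>Tgt i. if t \<in> N i then 1 else 0)"
      by (rule sum.cong) (simp_all add: one)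
    also have "\<dots> = card (Tgt i \<inter> N i)" by (simp add: sum.If_cases)
    also have "Tgt i \<inter> N i = N i" by (auto simp: N_def)
    finally show ?thesis using i finF cF by simp
  qed
  \<comment> \<open>Objects are natural numbers, so the pair of a primary and a finite target set is
    coded as one number. Every number decodes to such a pair.\<close>
  define enc where "enc i T = prod_encode (i, set_encode T)" for i T
  define prim where "prim x = fst (prod_decode x)" for x
  define tg where "tg x = set_decode (snd (prod_decode x))" for x
  have prim_enc [simp]: "prim (enc i T) = i" for i T
    by (simp add: prim_def enc_def)
  have tg_enc [simp]: "finite T \<Longrightarrow> tg (enc i T) = T" for i T
    by (simp add: tg_def enc_def)
  have enc_dec: "enc (prim x) (tg x) = x" for x
    by (simp add: prim_def enc_def tg_def)
  define Obj where "Obj = {x. prim x < v \<and> tg x \<subseteq> Tgt (prim x) \<and> card (tg x) = q}"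
  define S where "S = {x \<in> Obj. prim x \<in> F \<and> tg x \<subseteq> N (prim x)}"
  have finO: "finite Obj"
  proof (rule finite_subset)
    show "Obj \<subseteq> (\<lambda>(i, T). enc i T) ` ({..<v} \<times> Pow {..<v})"
    proof
      fix x assume "x \<in> Obj"
      then have "(prim x, tg x) \<in> {..<v} \<times> Pow {..<v}" using Tgt_less by (auto simp: Obj_def)
      then show "x \<in> (\<lambda>(i, T). enc i T) ` ({..<v} \<times> Pow {..<v})"
        by (rule rev_image_eqI) (simp add: enc_dec)
    qed
  qed simp
  define R where "R j h = {x \<in> Obj. prim x = h \<and> j \<in> tg x}" for j h
  have finR [simp]: "finite (R j h)" for j h using finO by (simp add: R_def)
  have card_enc: "card {x. prim x = h \<and> tg x \<subseteq> X \<and> card (tg x) = q \<and> j \<in> tg x} =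
      (card X choose q) - ((card X - 1) choose q)" if "finite X" "j \<in> X" for h X j
  proof -
    have finT: "finite T" if "T \<subseteq> X" for T using that \<open>finite X\<close> finite_subset by blast
    have "{x. prim x = h \<and> tg x \<subseteq> X \<and> card (tg x) = q \<and> j \<in> tg x} =
        enc h ` {T. T \<subseteq> X \<and> card T = q \<and> j \<in> T}" (is "?L = ?R")
    proof
      show "?L \<subseteq> ?R"
      proof
        fix x assume "x \<in> ?L"
        then show "x \<in> ?R" using enc_dec[of x] by (intro rev_image_eqI[of "tg x"]) auto
      qed
      show "?R \<subseteq> ?L" by (auto simp: finT)
    qed
    moreover have "inj_on (enc h) {T. T \<subseteq> X \<and> card T = q \<and> j \<in> T}"
      by (rule inj_on_inverseI[of _ tg]) (simp add: finT)
    ultimately show ?thesis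
      using card_subsets_containing[OF that] by (simp add: card_image)
  qed
  \<comment> \<open>\<open>M\<close> counts the replicas a node gets from each source,
    \<open>c\<close> those lying in \<open>S\<close> when the node has two sources in
    \<open>F\<close> and the source is one of them. For \<open>q = 0\<close> both vanish and there
    are no parities.\<close>
  define M where "M = (k choose q) - ((k - 1) choose q)"
  define c where "c = (lam * (p - 1) choose q) - ((lam * (p - 1) - 1) choose q)"
  have cR: "card (R j h) = M" if "j < v" "h \<in> Src j" for j h
  proof -
    have hv: "h < v" "j \<in> Tgt h" using that Src_less mem_Src_iff by blast+
    have "R j h = {x. prim x = h \<and> tg x \<subseteq> Tgt h \<and> card (tg x) = q \<and> j \<in> tg x}"
      using hv by (auto simp: R_def Obj_def)
    then show ?thesis using card_enc[of "Tgt h" j h] hv card_tgt[of h] by (simp add: M_def)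
  qed
  have cS: "card (R j h \<inter> S) = (if h \<in> F \<and> card (Src j \<inter> F) = 2 then c else 0)"
    if "j < v" "h \<in> Src j" for j h
  proof -
    have hv: "h < v" "j \<in> Tgt h" using that Src_less mem_Src_iff by blast+
    show ?thesis
    proof (cases "h \<in> F \<and> card (Src j \<inter> F) = 2")
      case True
      then have "R j h \<inter> S = {x. prim x = h \<and> tg x \<subseteq> N h \<and> card (tg x) = q \<and> j \<in> tg x}"
        using hv by (auto simp: R_def Obj_def S_def N_def)
      moreover have "finite (N h)" "j \<in> N h" using True hv by (auto simp: N_def)
      ultimately show ?thesis using card_enc[of "N h" j h] True cN[of h] by (simp add: c_def)
    next
      case False
      then have "R j h \<inter> S = {}" by (auto simp: R_def S_def N_def)
      then show ?thesis using False by auto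
    qed
  qed
  have "\<exists>f. bij_betw f {..<card (R j h)} (R j h) \<and>
      (\<forall>m<card (R j h). f m \<in> R j h \<inter> S \<longleftrightarrow> m < card (R j h \<inter> S))" for j h
    using bij_betw_initial_segment[of "R j h" "R j h \<inter> S"] by (metis finR inf_le1)
  then obtain f where f: "\<And>j h. bij_betw (f j h) {..<card (R j h)} (R j h)"
    and fS: "\<And>j h m. m < card (R j h) \<Longrightarrow> f j h m \<in> R j h \<inter> S \<longleftrightarrow> m < card (R j h \<inter> S)"
    by metis
  have fR: "f j h m \<in> R j h" if "j < v" "h \<in> Src j" "m < M" for j h m
    using bij_betwE[OF f[of j h]] cR that by auto
  have prim_f: "prim (f j h m) = h" if "j < v" "h \<in> Src j" "m < M" for j h m
    using fR[OF that] by (simp add: R_def)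
  have R_f: "\<exists>m<M. x = f j h m" if "j < v" "h \<in> Src j" "x \<in> R j h" for j h x
    using bij_betw_imp_surj_on[OF f[of j h]] cR that by auto
  have inj_f: "m = m'" if "j < v" "h \<in> Src j" "m < M" "m' < M" "f j h m = f j h m'" for j h m m'
    using bij_betw_imp_inj_on[OF f[of j h]] cR that by (auto simp: inj_on_def)
  \<comment> \<open>Tuple \<open>m\<close> takes the \<open>m\<close>-th object of every source. As
    \<open>S\<close> is listed first, both sources in \<open>F\<close> contribute objects of
    \<open>S\<close> to exactly the tuples with \<open>m < c\<close>.\<close>
  define tup where "tup j m = (\<lambda>h. f j h m) ` Src j" for j m
  define pl where "pl = \<lparr>objects = Obj, word_length = 1, primary = prim, targets = tg,
      tuples = (\<lambda>j. tup j ` {..<M})\<rparr>"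
  have rec: "received pl j = {x \<in> Obj. j \<in> tg x}" for j
    by (simp add: received_def pl_def)
  have inj_tup: "inj_on (\<lambda>h. f j h m) (Src j)" if "j < v" "m < M" for j m
    by (rule inj_on_inverseI[of _ prim]) (simp add: prim_f that)
  have "legal_placement v k A q pl"
    unfolding legal_placement_def
  proof (intro conjI ballI allI impI)
    fix j assume jv: "j < v"
    show "partition_on (received pl j) (tuples pl j)"
    proof (rule partition_onI)
      show "\<Union> (tuples pl j) = received pl j"
      proof
        show "\<Union> (tuples pl j) \<subseteq> received pl j"
        proof
          fix x assume "x \<in> \<Union> (tuples pl j)"
          then obtain m h where "m < M" "h \<in> Src j" "x = f j h m"
            by (auto simp: pl_def tup_def)
          then show "x \<in> received pl j" using fR[OF jv] by (auto simp: rec R_def)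
        qed
        show "received pl j \<subseteq> \<Union> (tuples pl j)"
        proof
          fix x assume "x \<in> received pl j"
          then have x: "x \<in> R j (prim x)" "prim x \<in> Src j"
            using jv mem_Src_iff by (auto simp: rec R_def Obj_def)
          then obtain m where "m < M" "x = f j (prim x) m" using R_f jv by blast
          then have "x \<in> tup j m" using x(2) unfolding tup_def by blast
          then show "x \<in> \<Union> (tuples pl j)" using \<open>m < M\<close> by (auto simp: pl_def)
        qed
      qed
    next
      fix t t' assume "t \<in> tuples pl j" "t' \<in> tuples pl j" "t \<noteq> t'"
      then obtain m m' where m: "m < M" "m' < M" "t = tup j m" "t' = tup j m'" "m \<noteq> m'"
        by (auto simp: pl_def)
      show "disjnt t t'"
        unfolding disjnt_iff
      proof (intro allI notI)
        fix x assume "x \<in> t \<and> x \<in> t'"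
        then obtain h h' where h: "h \<in> Src j" "h' \<in> Src j" "x = f j h m" "x = f j h' m'"
          using m by (auto simp: tup_def)
        then have "h = h'" using prim_f jv m by metis
        then show False using inj_f jv h m by metis
      qed
    next
      have "Src j \<noteq> {}" using card_src[OF jv] k_pos by auto
      then show "{} \<notin> tuples pl j" by (auto simp: pl_def tup_def)
    qed
    fix t assume "t \<in> tuples pl j"
    then obtain m where m: "m < M" "t = tup j m" by (auto simp: pl_def)
    show "card t = k"
      using inj_tup[OF jv m(1)] card_src[OF jv] by (simp add: m(2) tup_def card_image)
    fix h assume h: "h \<in> Src j"
    show "\<exists>!x. x \<in> t \<and> primary pl x = h"
    proof (rule ex1I[of _ "f j h m"])
      show "f j h m \<in> t \<and> primary pl (f j h m) = h"
        using h m jv prim_f by (auto simp: pl_def tup_def)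
      show "x = f j h m" if "x \<in> t \<and> primary pl x = h" for x
        using that m jv prim_f by (auto simp: pl_def tup_def)
    qed
  qed (use finO in \<open>auto simp: pl_def Obj_def\<close>)
  moreover have "\<not> permits_recovery v pl F"
  proof
    assume rec: "permits_recovery v pl F"
    \<comment> \<open>The all-zero assignment and the indicator of \<open>S\<close> will be
      indistinguishable from the alive data.\<close>
    define val :: "nat \<Rightarrow> nat \<Rightarrow> bit" where "val x = (\<lambda>l\<in>{..<1}. 0)" for x
    define val' :: "nat \<Rightarrow> nat \<Rightarrow> bit" where "val' x = (\<lambda>l\<in>{..<1}. if x \<in> S then 1 else 0)" for x
    have "F \<noteq> {}" using cF by auto
    then obtain i where i: "i \<in> F" by blast
    \<comment> \<open>This is where \<open>q \<le> lam * (p - 1)\<close> enters: it makes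
      \<open>S\<close> nonempty.\<close>
    obtain T where T: "T \<subseteq> N i" "card T = q" "finite T"
      using q obtain_subset_with_card_n[of q "N i"] by (metis cN[OF i])
    have "enc i T \<in> S" using T i F by (auto simp: S_def Obj_def N_def)
    have parity: "parity_word 1 val (tup j m) = parity_word 1 val' (tup j m)"
      if jv: "j < v" and m: "m < M" for j m
    proof -
      have fS': "f j h m \<in> S \<longleftrightarrow> h \<in> F \<and> card (Src j \<inter> F) = 2 \<and> m < c" if h: "h \<in> Src j" for h
        using fS[of m j h] fR[OF jv h m] cR[OF jv h] cS[OF jv h] m by auto
      have "(\<Sum>x\<in>tup j m. val' x 0) = (\<Sum>h\<in>Src j. val' (f j h m) 0)"
        unfolding tup_def by (rule sum.reindex_cong[OF inj_tup[OF jv m]]) simp_all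
      also have "\<dots> = (\<Sum>h\<in>Src j. if h \<in> F \<and> card (Src j \<inter> F) = 2 \<and> m < c then 1 else 0)"
        by (rule sum.cong) (simp_all add: val'_def fS')
      \<comment> \<open>A tuple meets \<open>S\<close> in zero or two objects, and
        \<open>1 + 1 = 0\<close> in \<open>bit\<close>.\<close>
      also have "\<dots> = 0"
      proof (cases "card (Src j \<inter> F) = 2 \<and> m < c")
        case True
        then have "(\<Sum>h\<in>Src j. if h \<in> F \<and> card (Src j \<inter> F) = 2 \<and> m < c then 1 else 0) =
            (\<Sum>h\<in>Src j \<inter> F. 1 :: bit)"
          by (simp add: sum.If_cases)
        also have "\<dots> = of_nat (card (Src j \<inter> F))" by simp
        also have "\<dots> = 0" using True by simp
        finally show ?thesis .
      qed auto
      finally show ?thesis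
        by (auto simp: parity_word_def val_def fun_eq_iff)
    qed
    have "val (enc i T) = val' (enc i T)"
    proof -
      have "val \<in> objects pl \<rightarrow> words (word_length pl)" "val' \<in> objects pl \<rightarrow> words (word_length pl)"
        by (auto simp: pl_def words_def val_def val'_def)
      moreover have "\<forall>x\<in>objects pl. primary pl x \<notin> F \<longrightarrow> val x = val' x"
        by (auto simp: pl_def val_def val'_def S_def)
      moreover have "\<forall>j<v. j \<notin> F \<longrightarrow> (\<forall>t\<in>tuples pl j.
          parity_word (word_length pl) val t = parity_word (word_length pl) val' t)"
        using parity by (auto simp: pl_def)
      moreover have "enc i T \<in> objects pl" "primary pl (enc i T) \<in> F"
        using \<open>enc i T \<in> S\<close> by (auto simp: pl_def S_def)
      ultimately show ?thesis using rec unfolding permits_recovery_def by blast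
    qed
    then have "val (enc i T) 0 = val' (enc i T) 0" by simp
    then show False using \<open>enc i T \<in> S\<close> by (simp add: val_def val'_def)
  qed
  ultimately show ?thesis using that by blast
qed

end

section \<open>From labelled designs to matrices\<close>

lemma symmetric_design_of_representative:
  assumes sb: "sbibd v k lam P B inc" and rep: "representative v P B inc A"
  shows "symmetric_design v k lam A"
proof -
  obtain pt bl where pt: "bij_betw pt {..<v} P" and bl: "bij_betw bl {..<v} B"
    and A: "\<And>i j. \<lbrakk>i < v; j < v\<rbrakk> \<Longrightarrow> A i j = (if inc (pt i) (bl j) then 1 else 0)"
    using rep unfolding representative_def by blast
  have card_pull: "card {j. j < v \<and> Q (g j)} = card {y \<in> Y. Q y}"
    if g: "bij_betw g {..<v} Y" for g :: "nat \<Rightarrow> 'z" and Y Q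
  proof -
    have "bij_betw g {j. j < v \<and> Q (g j)} {y \<in> Y. Q y}"
      using g by (auto simp: bij_betw_def inj_on_def)
    then show ?thesis by (rule bij_betw_same_card)
  qed
  have ptP: "pt i \<in> P" if "i < v" for i using bij_betwE[OF pt] that by auto
  have blB: "bl j \<in> B" if "j < v" for j using bij_betwE[OF bl] that by auto
  have tgt_eq: "tgt v A i = {j. j < v \<and> inc (pt i) (bl j)}" if "i < v" for i
    using A that by (auto simp: tgt_def split: if_splits)
  show ?thesis
  proof
    show "A i j = 0 \<or> A i j = 1" if "i < v" "j < v" for i j using A that by simp
    show "card (tgt v A i) = k" if "i < v" for i
      using card_pull[OF bl, of "inc (pt i)"] sb ptP that by (simp add: tgt_eq sbibd_def)
    show "card (src v A j) = k" if "j < v" for j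
    proof -
      have "src v A j = {i. i < v \<and> inc (pt i) (bl j)}"
        using A that by (auto simp: src_def split: if_splits)
      then show ?thesis
        using card_pull[OF pt, of "\<lambda>x. inc x (bl j)"] sb blB that by (simp add: sbibd_def)
    qed
    show "card (tgt v A i \<inter> tgt v A h) = lam" if "i < v" "h < v" "i \<noteq> h" for i h
    proof -
      have "tgt v A i \<inter> tgt v A h = {j. j < v \<and> inc (pt i) (bl j) \<and> inc (pt h) (bl j)}"
        using that by (auto simp: tgt_eq)
      moreover have "pt i \<noteq> pt h"
        using bij_betw_imp_inj_on[OF pt] that by (auto simp: inj_on_def)
      ultimately show ?thesis
        using card_pull[OF bl, of "\<lambda>b. inc (pt i) b \<and> inc (pt h) b"] sb ptP that
        by (simp add: sbibd_def)
    qed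
    show "0 < lam" "0 < k" using sb by (auto simp: sbibd_def)
  qed
qed

section \<open>Bounds on the threshold\<close>

theorem mainTheorem4:
  fixes v k lam p :: nat and P :: "'p set" and B :: "'b set" and inc :: "'p \<Rightarrow> 'b \<Rightarrow> bool"
    and A :: "nat \<Rightarrow> nat \<Rightarrow> nat" and F :: "nat set"
  assumes "p \<ge> 3"
    and "sbibd v k lam P B inc"
    and "representative v P B inc A"
    and "zero_diagonal v A"
    and "pairwise_separated v A F"
    and "card F = p"
    and "k \<ge> lam * (p - 1) + 2"
  shows "(\<exists>pl G. legal_placement v k A (lam * (p - 1)) pl \<and>
            G \<subseteq> {..<v} \<and> card G \<le> p \<and> \<not> permits_recovery v pl G) \<and>
         (\<exists>q\<le>k. guarantees_recovery v k A p q) \<and>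
         lam * (p - 1) + 1 \<le> universal_threshold v k A p \<and>
         universal_threshold v k A p \<le> lam * (p - 1) + 2"
proof -
  interpret symmetric_design v k lam A
    by (rule symmetric_design_of_representative[OF assms(2,3)])
  have F: "F \<subseteq> {..<v}" using assms(5) by (simp add: pairwise_separated_def)
  have p: "1 \<le> p" using assms(1) by simp
  have bad: "\<exists>pl. legal_placement v k A q pl \<and> \<not> permits_recovery v pl F"
    if "q \<le> lam * (p - 1)" for q
    using no_guarantee_below[OF assms(5,6) p that] by blast
  \<comment> \<open>The bound on \<open>k\<close> keeps the candidate
    \<open>lam * (p - 1) + 2\<close> in range. Its existence shows that the least value is attained,
    so the threshold itself guarantees recovery.\<close>
  let ?ok = "\<lambda>q. q \<le> k \<and> guarantees_recovery v k A p q"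
  have up: "?ok (lam * (p - 1) + 2)"
    using guarantees_recovery_upper[OF p] assms(7) by simp
  have "?ok (universal_threshold v k A p)"
    unfolding universal_threshold_def by (rule LeastI[of ?ok, OF up])
  then have "\<not> universal_threshold v k A p \<le> lam * (p - 1)"
    using bad F assms(6) unfolding guarantees_recovery_def by blast
  moreover have "universal_threshold v k A p \<le> lam * (p - 1) + 2"
    unfolding universal_threshold_def by (rule Least_le[of ?ok, OF up])
  moreover have "\<exists>pl G. legal_placement v k A (lam * (p - 1)) pl \<and>
      G \<subseteq> {..<v} \<and> card G \<le> p \<and> \<not> permits_recovery v pl G"
    using bad[OF order_refl] F assms(6) by blast
  ultimately show ?thesis using up by auto
qed

end
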